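(* Let $\lambda>0$, $T>0$, and let $0<\sigma_1<\bar\sigma<\sigma_2$ satisfy $(\sigma_1+\sigma_2)/2=\bar\sigma$. Consider the bottleneck system $\dot x(t)=\sigma(t)(1-x(t))-\lambda x(t)$, and let $B_{\bar\sigma,T}$ and $J$ be as defined in the context. If $\sigma\in B_{\bar\sigma,T}$, then $J(\sigma)\le 1$, that is, $$\frac1T\int_0^T \lambda x_\sigma(t)\,dt\ \le\ \frac{\lambda\bar\sigma}{\lambda+\bar\sigma}.$$
   Context: For a bounded measurable $T$-periodic inflow $\sigma:[0,\infty)\to(0,\infty)$, the system $\dot x=\sigma(t)(1-x)-\lambda x$ (with solutions understood as absolutely continuous functions satisfying the equation for almost every $t$) has a unique $T$-periodic solution, which takes values in $[0,1]$ and attracts all solutions with $x(0)\in[0,1]$; it is denoted $x_\sigma$. For a $T$-periodic function $f$, $\operatorname{ave}(f):=\frac1T\int_0^T f(s)\,ds$. The set of admissible inflows $B_{\bar\sigma,T}$ is the set of all measurable functions $\sigma:[0,\infty)\to\{\sigma_1,\bar\sigma,\sigma_2\}$ such that $\sigma(t+T)=\sigma(t)$ for all $t\ge 0$, $\operatorname{ave}(\sigma)=\bar\sigma$, and, for every $t$, $\sigma(t)=\bar\sigma$ implies $x_\sigma(t)=\bar\sigma/(\lambda+\bar\sigma)$. The performance functional is $J(\sigma):=\operatorname{ave}(\lambda x_\sigma)\big/\frac{\lambda\bar\sigma}{\lambda+\bar\sigma}$. *)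

theory Defs
  imports "HOL-Analysis.Analysis"
begin

text \<open>
  Functions with domain \<open>[0, \<infinity>)\<close> are represented by functions on \<^typ>\<open>real\<close>; every condition
  below concerns only their restriction to \<open>{0..}\<close>.
\<close>

definition periodic_nonneg :: "real \<Rightarrow> (real \<Rightarrow> real) \<Rightarrow> bool" where
  "periodic_nonneg T f \<longleftrightarrow> (\<forall>t\<ge>0. f (t + T) = f t)"

text \<open>
  The Lebesgue integral is taken over \<^term>\<open>lebesgue\<close>, not \<^term>\<open>lborel\<close>: the Bochner integral over
  \<^term>\<open>lborel\<close> is \<open>0\<close> by convention for functions that are not Borel measurable.
\<close>

definition ave :: "real \<Rightarrow> (real \<Rightarrow> real) \<Rightarrow> real" where
  "ave T f = 1 / T * (LINT s:{0..T}|lebesgue. f s)"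

text \<open>
  The usual \<open>\<epsilon>\<close>-\<open>\<delta>\<close> condition for finite families of non-overlapping compact intervals; a member
  \<open>k\<close> of the family has end points \<open>Inf k\<close> and \<open>Sup k\<close>.
\<close>

definition abs_continuous_on :: "real set \<Rightarrow> (real \<Rightarrow> real) \<Rightarrow> bool" where
  "abs_continuous_on S f \<longleftrightarrow>
     (\<forall>\<epsilon>>0. \<exists>\<delta>>0. \<forall>\<D>. \<D> division_of \<Union>\<D> \<and> \<Union>\<D> \<subseteq> S \<and> (\<Sum>k\<in>\<D>. Sup k - Inf k) < \<delta>
        \<longrightarrow> (\<Sum>k\<in>\<D>. \<bar>f (Sup k) - f (Inf k)\<bar>) < \<epsilon>)"

text \<open>On the unbounded time axis, absolute continuity is meant on every compact interval.\<close>

definition bottleneck_solution :: "real \<Rightarrow> (real \<Rightarrow> real) \<Rightarrow> (real \<Rightarrow> real) \<Rightarrow> bool" where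
  "bottleneck_solution lam \<sigma> x \<longleftrightarrow>
     (\<forall>b\<ge>0. abs_continuous_on {0..b} x) \<and>
     (AE t in lebesgue_on {0..}.
        (x has_real_derivative \<sigma> t * (1 - x t) - lam * x t) (at t within {0..}))"

text \<open>
  The periodic solution is unique only as a function on \<open>{0..}\<close>; membership in
  \<^term>\<open>extensional {0..}\<close> fixes its irrelevant values at negative times.
\<close>

definition periodic_solution :: "real \<Rightarrow> real \<Rightarrow> (real \<Rightarrow> real) \<Rightarrow> real \<Rightarrow> real" where
  "periodic_solution lam T \<sigma> =
     (THE x. x \<in> extensional {0..} \<and> bottleneck_solution lam \<sigma> x \<and> periodic_nonneg T x)"

definition admissible_inflows ::
    "real \<Rightarrow> real \<Rightarrow> real \<Rightarrow> real \<Rightarrow> real \<Rightarrow> (real \<Rightarrow> real) set" where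
  "admissible_inflows lam \<sigma>\<^sub>1 \<sigma>\<^sub>2 \<sigma>bar T =
     {\<sigma>. \<sigma> \<in> borel_measurable (lebesgue_on {0..}) \<and>
         (\<forall>t\<ge>0. \<sigma> t \<in> {\<sigma>\<^sub>1, \<sigma>bar, \<sigma>\<^sub>2}) \<and>
         periodic_nonneg T \<sigma> \<and>
         ave T \<sigma> = \<sigma>bar \<and>
         (\<forall>t\<ge>0. \<sigma> t = \<sigma>bar \<longrightarrow> periodic_solution lam T \<sigma> t = \<sigma>bar / (lam + \<sigma>bar))}"

definition performance :: "real \<Rightarrow> real \<Rightarrow> real \<Rightarrow> (real \<Rightarrow> real) \<Rightarrow> real" where
  "performance lam \<sigma>bar T \<sigma> =
     ave T (\<lambda>t. lam * periodic_solution lam T \<sigma> t) / (lam * \<sigma>bar / (lam + \<sigma>bar))"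

end

theory Submission
  imports Defs
begin

text \<open>
  With \<open>z = 1 - x\<close> the equation becomes \<open>z' = lam - (lam + \<sigma>) z\<close>. The periodic solution is positive, so
  dividing by \<open>z\<close> and averaging over a period, where \<open>z' / z = (ln z)'\<close> averages to \<open>0\<close>, gives
  \<open>ave (1 / z) = 1 / q\<close> with \<open>q = lam / (lam + ave \<sigma>)\<close>. By Jensen's inequality, in the form
  \<open>z \<ge> 2 q - q\<^sup>2 / z\<close>, the average of \<open>z\<close> is at least \<open>q\<close>, hence that of \<open>x\<close> is at most
  \<open>1 - q = ave \<sigma> / (lam + ave \<sigma>)\<close>. That the periodic solution exists and is unique is
  Lebesgue's differentiation theorem for the explicit formula, respectively the fundamental theorem of
  calculus for the square of the difference of two absolutely continuous solutions.
\<close>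

subsection \<open>Absolutely continuous functions\<close>

lemma abs_continuous_onE:
  assumes "abs_continuous_on S f" and "\<epsilon> > 0"
  obtains \<delta> where "\<delta> > 0"
    and "\<And>\<D>. \<lbrakk>\<D> division_of \<Union>\<D>; \<Union>\<D> \<subseteq> S; (\<Sum>k\<in>\<D>. Sup k - Inf k) < \<delta>\<rbrakk>
           \<Longrightarrow> (\<Sum>k\<in>\<D>. \<bar>f (Sup k) - f (Inf k)\<bar>) < \<epsilon>"
  using assms unfolding abs_continuous_on_def by meson

lemma division_of_real_ends:
  fixes k :: "real set"
  assumes "\<D> division_of \<Union>\<D>" and "k \<in> \<D>"
  shows "Inf k \<in> k" "Sup k \<in> k" "Inf k \<le> Sup k"
proof -
  obtain a b where "k = cbox a b" "k \<noteq> {}"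
    using division_ofD(3,4)[OF assms] by blast
  then show "Inf k \<in> k" "Sup k \<in> k" "Inf k \<le> Sup k"
    by auto
qed

text \<open>Composition with \<open>g\<close> enlarges increments of \<open>f\<close> by at most the
  factor \<open>L\<close>. The \<open>\<delta>\<close> is taken for
  \<open>\<epsilon> / (L + 1)\<close>, which stays meaningful for \<open>L = 0\<close> and makes the
  final inequality strict.\<close>

lemma abs_continuous_on_lipschitz_compose:
  assumes f: "abs_continuous_on S f" and g: "L-lipschitz_on (f ` S) g"
  shows "abs_continuous_on S (\<lambda>x. g (f x))"
  unfolding abs_continuous_on_def
proof (intro allI impI)
  fix \<epsilon> :: real
  assume "\<epsilon> > 0"
  have L: "L \<ge> 0"
    using g by (rule lipschitz_on_nonneg)
  with \<open>\<epsilon> > 0\<close> have eL: "\<epsilon> / (L + 1) > 0"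
    by simp
  obtain \<delta> where "\<delta> > 0"
    and \<delta>: "\<And>\<D>. \<lbrakk>\<D> division_of \<Union>\<D>; \<Union>\<D> \<subseteq> S; (\<Sum>k\<in>\<D>. Sup k - Inf k) < \<delta>\<rbrakk>
             \<Longrightarrow> (\<Sum>k\<in>\<D>. \<bar>f (Sup k) - f (Inf k)\<bar>) < \<epsilon> / (L + 1)"
    by (rule abs_continuous_onE[OF f eL]) (rule that)
  show "\<exists>\<delta>>0. \<forall>\<D>. \<D> division_of \<Union>\<D> \<and> \<Union>\<D> \<subseteq> S \<and> (\<Sum>k\<in>\<D>. Sup k - Inf k) < \<delta>
          \<longrightarrow> (\<Sum>k\<in>\<D>. \<bar>g (f (Sup k)) - g (f (Inf k))\<bar>) < \<epsilon>"
  proof (intro exI[of _ \<delta>] conjI allI impI \<open>\<delta> > 0\<close>; elim conjE)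
    fix \<D> :: "real set set"
    assume D: "\<D> division_of \<Union>\<D>" "\<Union>\<D> \<subseteq> S" "(\<Sum>k\<in>\<D>. Sup k - Inf k) < \<delta>"
    have "(\<Sum>k\<in>\<D>. \<bar>g (f (Sup k)) - g (f (Inf k))\<bar>) \<le> (\<Sum>k\<in>\<D>. L * \<bar>f (Sup k) - f (Inf k)\<bar>)"
    proof (rule sum_mono)
      fix k assume k: "k \<in> \<D>"
      then have "Sup k \<in> S" "Inf k \<in> S"
        using division_of_real_ends[OF D(1) k] D(2) by auto
      then show "\<bar>g (f (Sup k)) - g (f (Inf k))\<bar> \<le> L * \<bar>f (Sup k) - f (Inf k)\<bar>"
        using lipschitz_onD[OF g] by (simp add: dist_real_def)
    qed
    also have "\<dots> = L * (\<Sum>k\<in>\<D>. \<bar>f (Sup k) - f (Inf k)\<bar>)"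
      by (simp add: sum_distrib_left)
    also have "\<dots> \<le> L * (\<epsilon> / (L + 1))"
      using \<delta>[OF D] L by (intro mult_left_mono) auto
    also have "\<dots> < \<epsilon>"
      using L \<open>\<epsilon> > 0\<close> by (simp add: field_simps)
    finally show "(\<Sum>k\<in>\<D>. \<bar>g (f (Sup k)) - g (f (Inf k))\<bar>) < \<epsilon>" .
  qed
qed

lemma abs_continuous_on_id: "abs_continuous_on S (\<lambda>x. x)"
  unfolding abs_continuous_on_def
proof (intro allI impI)
  fix \<epsilon> :: real
  assume "\<epsilon> > 0"
  moreover have "(\<Sum>k\<in>\<D>. \<bar>Sup k - Inf k\<bar>) = (\<Sum>k\<in>\<D>. Sup k - Inf k)"
    if "\<D> division_of \<Union>\<D>" for \<D> :: "real set set"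
    using division_of_real_ends(3)[OF that] by (intro sum.cong) auto
  ultimately show "\<exists>\<delta>>0. \<forall>\<D>. \<D> division_of \<Union>\<D> \<and> \<Union>\<D> \<subseteq> S \<and> (\<Sum>k\<in>\<D>. Sup k - Inf k) < \<delta>
          \<longrightarrow> (\<Sum>k\<in>\<D>. \<bar>Sup k - Inf k\<bar>) < \<epsilon>"
    by (intro exI[of _ \<epsilon>]) auto
qed

text \<open>Composition of \<open>f\<close> with the identity; this is how the explicit solution is
  seen to be absolutely continuous.\<close>

lemma lipschitz_on_imp_abs_continuous_on:
  fixes f :: "real \<Rightarrow> real"
  assumes "L-lipschitz_on S f"
  shows "abs_continuous_on S f"
  using abs_continuous_on_lipschitz_compose[OF abs_continuous_on_id, of L S f] assms by simp

lemma abs_continuous_on_diff: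
  assumes f: "abs_continuous_on S f" and g: "abs_continuous_on S g"
  shows "abs_continuous_on S (\<lambda>x. f x - g x)"
  unfolding abs_continuous_on_def
proof (intro allI impI)
  fix \<epsilon> :: real
  assume "\<epsilon> > 0"
  then have e2: "\<epsilon> / 2 > 0"
    by simp
  obtain d1 where "d1 > 0"
    and d1: "\<And>\<D>. \<lbrakk>\<D> division_of \<Union>\<D>; \<Union>\<D> \<subseteq> S; (\<Sum>k\<in>\<D>. Sup k - Inf k) < d1\<rbrakk>
             \<Longrightarrow> (\<Sum>k\<in>\<D>. \<bar>f (Sup k) - f (Inf k)\<bar>) < \<epsilon> / 2"
    by (rule abs_continuous_onE[OF f e2]) (rule that)
  obtain d2 where "d2 > 0"
    and d2: "\<And>\<D>. \<lbrakk>\<D> division_of \<Union>\<D>; \<Union>\<D> \<subseteq> S; (\<Sum>k\<in>\<D>. Sup k - Inf k) < d2\<rbrakk>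
             \<Longrightarrow> (\<Sum>k\<in>\<D>. \<bar>g (Sup k) - g (Inf k)\<bar>) < \<epsilon> / 2"
    by (rule abs_continuous_onE[OF g e2]) (rule that)
  show "\<exists>\<delta>>0. \<forall>\<D>. \<D> division_of \<Union>\<D> \<and> \<Union>\<D> \<subseteq> S \<and> (\<Sum>k\<in>\<D>. Sup k - Inf k) < \<delta>
          \<longrightarrow> (\<Sum>k\<in>\<D>. \<bar>f (Sup k) - g (Sup k) - (f (Inf k) - g (Inf k))\<bar>) < \<epsilon>"
  proof (intro exI[of _ "min d1 d2"] conjI allI impI; (elim conjE)?)
    fix \<D> :: "real set set"
    assume D: "\<D> division_of \<Union>\<D>" "\<Union>\<D> \<subseteq> S" "(\<Sum>k\<in>\<D>. Sup k - Inf k) < min d1 d2"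
    have "(\<Sum>k\<in>\<D>. \<bar>f (Sup k) - g (Sup k) - (f (Inf k) - g (Inf k))\<bar>)
          \<le> (\<Sum>k\<in>\<D>. \<bar>f (Sup k) - f (Inf k)\<bar> + \<bar>g (Sup k) - g (Inf k)\<bar>)"
      by (intro sum_mono) linarith
    also have "\<dots> < \<epsilon>"
      unfolding sum.distrib using d1[OF D(1,2)] d2[OF D(1,2)] D(3) by force
    finally show "(\<Sum>k\<in>\<D>. \<bar>f (Sup k) - g (Sup k) - (f (Inf k) - g (Inf k))\<bar>) < \<epsilon>" .
  qed (use \<open>d1 > 0\<close> \<open>d2 > 0\<close> in simp)
qed

text \<open>A single interval \<open>{u..v}\<close> is already a division of itself, so the
  \<open>\<delta>\<close> of absolute continuity is one of uniform continuity.\<close>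

lemma abs_continuous_on_imp_continuous_on:
  assumes f: "abs_continuous_on {a..b} f"
  shows "continuous_on {a..b} f"
  unfolding continuous_on_iff
proof (intro ballI allI impI)
  fix x \<epsilon> :: real
  assume x: "x \<in> {a..b}" and "\<epsilon> > 0"
  obtain \<delta> where "\<delta> > 0"
    and \<delta>: "\<And>\<D>. \<lbrakk>\<D> division_of \<Union>\<D>; \<Union>\<D> \<subseteq> {a..b}; (\<Sum>k\<in>\<D>. Sup k - Inf k) < \<delta>\<rbrakk>
             \<Longrightarrow> (\<Sum>k\<in>\<D>. \<bar>f (Sup k) - f (Inf k)\<bar>) < \<epsilon>"
    by (rule abs_continuous_onE[OF f \<open>\<epsilon> > 0\<close>]) (rule that)
  have *: "\<bar>f v - f u\<bar> < \<epsilon>" if "u \<in> {a..b}" "v \<in> {a..b}" "u \<le> v" "v - u < \<delta>" for u v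
  proof -
    have "{{u..v}} division_of \<Union>{{u..v}}"
      using division_of_self[of u v] that by simp
    then show ?thesis
      using \<delta>[of "{{u..v}}"] that by simp
  qed
  show "\<exists>\<delta>>0. \<forall>y\<in>{a..b}. dist y x < \<delta> \<longrightarrow> dist (f y) (f x) < \<epsilon>"
  proof (intro exI[of _ \<delta>] conjI ballI impI \<open>\<delta> > 0\<close>)
    fix y assume "y \<in> {a..b}" "dist y x < \<delta>"
    then show "dist (f y) (f x) < \<epsilon>"
      using *[of x y] *[of y x] x by (cases "x \<le> y") (auto simp: dist_real_def abs_minus_commute)
  qed
qed

section \<open>The fundamental theorem of calculus for absolutely continuous functions\<close>

text \<open>The errors of the linear approximation on \<open>{u..x}\<close> and
  \<open>{x..v}\<close> are at most \<open>e * (x - u)\<close> and \<open>e * (v - x)\<close>; since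
  \<open>x\<close> lies between \<open>u\<close> and \<open>v\<close>, they add up to
  \<open>e * (v - u)\<close>.\<close>

lemma has_real_derivative_straddle:
  assumes "(f has_real_derivative D) (at x within S)" and "e > 0"
  obtains d where "d > 0"
    and "\<And>u v. \<lbrakk>u \<in> S; v \<in> S; u \<le> x; x \<le> v; {u..v} \<subseteq> ball x d\<rbrakk>
           \<Longrightarrow> \<bar>(v - u) * D - (f v - f u)\<bar> \<le> e * (v - u)"
proof -
  obtain d where "d > 0"
    and d: "\<And>y. \<lbrakk>y \<in> S; \<bar>y - x\<bar> < d\<rbrakk> \<Longrightarrow> \<bar>f y - f x - D * (y - x)\<bar> \<le> e * \<bar>y - x\<bar>"
    using assms unfolding has_field_derivative_def has_derivative_within_alt by force
  show thesis
  proof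
    fix u v assume uv: "u \<in> S" "v \<in> S" "u \<le> x" "x \<le> v" "{u..v} \<subseteq> ball x d"
    moreover have "u \<in> {u..v}" "v \<in> {u..v}"
      using uv(3,4) by simp_all
    ultimately have "u \<in> ball x d" "v \<in> ball x d"
      by blast+
    then have "\<bar>f u - f x - D * (u - x)\<bar> \<le> e * \<bar>u - x\<bar>" "\<bar>f v - f x - D * (v - x)\<bar> \<le> e * \<bar>v - x\<bar>"
      using d[of u] d[of v] uv by (auto simp: dist_real_def)
    then have "\<bar>f u - f x - D * (u - x)\<bar> + \<bar>f v - f x - D * (v - x)\<bar> \<le> e * (v - u)"
      using uv by (simp add: algebra_simps)
    then show "\<bar>(v - u) * D - (f v - f u)\<bar> \<le> e * (v - u)"
      by (simp add: algebra_simps)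
  qed fact
qed

text \<open>A gauge is chosen so that intervals tagged outside \<open>N\<close> obey the straddle
  estimate, while those tagged in \<open>N\<close> lie in an open set of small measure.\<close>

theorem fundamental_theorem_of_calculus_abs_continuous:
  fixes f f' :: "real \<Rightarrow> real"
  assumes ac: "abs_continuous_on {a..b} f" and ab: "a \<le> b" and N: "negligible N"
    and der: "\<And>x. x \<in> {a..b} - N \<Longrightarrow> (f has_real_derivative f' x) (at x within {a..b})"
  shows "(f' has_integral (f b - f a)) {a..b}"
proof -
  \<comment> \<open>On the null set the derivative is replaced by \<open>0\<close>, so that Riemann sums there only involve
      increments of \<open>f\<close>, which absolute continuity controls.\<close>
  define g where "g x = (if x \<in> N then 0 else f' x)" for x
  have "(g has_integral (f b - f a)) {a..b}"
    unfolding has_integral_real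
  proof (intro allI impI)
    fix e :: real
    assume "e > 0"
    then have "e / 2 > 0"
      by simp
    obtain \<delta> where "\<delta> > 0"
      and \<delta>: "\<And>\<D>. \<lbrakk>\<D> division_of \<Union>\<D>; \<Union>\<D> \<subseteq> {a..b}; (\<Sum>k\<in>\<D>. Sup k - Inf k) < \<delta>\<rbrakk>
             \<Longrightarrow> (\<Sum>k\<in>\<D>. \<bar>f (Sup k) - f (Inf k)\<bar>) < e / 2"
      by (rule abs_continuous_onE[OF ac \<open>e / 2 > 0\<close>]) (rule that)
    \<comment> \<open>Outer regularity bounds only the measure of \<open>U - N\<close>; adding the
      null set \<open>N\<close> back does not change it.\<close>
    obtain U where U: "open U" "N \<subseteq> U" "U \<in> lmeasurable" "measure lebesgue U < \<delta>"
    proof -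
      obtain U where U: "open U" "N \<subseteq> U" "U - N \<in> lmeasurable" "emeasure lebesgue (U - N) < ennreal \<delta>"
        using sets_lebesgue_outer_open[OF negligible_imp_sets[OF N] \<open>\<delta> > 0\<close>] by metis
      have "U = (U - N) \<union> N"
        using U(2) by blast
      have N': "N \<in> lmeasurable" "measure lebesgue N = 0"
        using N by (simp_all add: negligible_iff_measure)
      have lU: "U \<in> lmeasurable"
        by (subst \<open>U = (U - N) \<union> N\<close>) (rule fmeasurable.Un[OF U(3) N'(1)])
      have "measure lebesgue (U - N) < \<delta>"
        using U(3,4) \<open>\<delta> > 0\<close> by (simp add: emeasure_eq_measure2 ennreal_less_iff)
      moreover have "measure lebesgue U \<le> measure lebesgue (U - N) + measure lebesgue N"
        by (subst \<open>U = (U - N) \<union> N\<close>) (rule measure_Un_le[OF fmeasurableD[OF U(3)] fmeasurableD[OF N'(1)]])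
      ultimately show thesis
        using that[OF U(1,2) lU] N'(2) by linarith
    qed
    \<comment> \<open>The straddle errors will total at most \<open>e' * (b - a)\<close>; the
      summand \<open>1\<close> covers \<open>a = b\<close>.\<close>
    define e' where "e' = e / (2 * (b - a + 1))"
    have "e' > 0" "e' * (b - a) \<le> e / 2"
      using \<open>e > 0\<close> ab by (simp_all add: e'_def field_simps)
    \<comment> \<open>\<open>d\<close> is the radius of the gauge at \<open>x\<close>: inside
      \<open>U\<close> on \<open>N\<close>, from differentiability on the rest of
      \<open>{a..b}\<close>, arbitrary elsewhere.\<close>
    have "\<exists>d>0. (x \<in> N \<longrightarrow> ball x d \<subseteq> U) \<and>
            (x \<in> {a..b} - N \<longrightarrow> (\<forall>u\<in>{a..b}. \<forall>v\<in>{a..b}. u \<le> x \<and> x \<le> v \<and> {u..v} \<subseteq> ball x d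
               \<longrightarrow> \<bar>(v - u) * f' x - (f v - f u)\<bar> \<le> e' * (v - u)))" for x
    proof (cases "x \<in> N")
      case True
      then obtain d where "d > 0" "ball x d \<subseteq> U"
        using U(1,2) by (meson openE subsetD)
      then show ?thesis
        using True by auto
    next
      case False
      show ?thesis
      proof (cases "x \<in> {a..b}")
        case True
        then obtain d where "d > 0"
          and "\<And>u v. \<lbrakk>u \<in> {a..b}; v \<in> {a..b}; u \<le> x; x \<le> v; {u..v} \<subseteq> ball x d\<rbrakk>
                 \<Longrightarrow> \<bar>(v - u) * f' x - (f v - f u)\<bar> \<le> e' * (v - u)"
          using False has_real_derivative_straddle[OF der \<open>e' > 0\<close>, of x] by (metis DiffI)
        then show ?thesis
          using False by blast
      qed (use False zero_less_one in blast)
    qed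
    then obtain d where d: "\<And>x. d x > 0" "\<And>x. x \<in> N \<Longrightarrow> ball x (d x) \<subseteq> U"
      "\<And>x u v. \<lbrakk>x \<in> {a..b} - N; u \<in> {a..b}; v \<in> {a..b}; u \<le> x; x \<le> v; {u..v} \<subseteq> ball x (d x)\<rbrakk>
          \<Longrightarrow> \<bar>(v - u) * f' x - (f v - f u)\<bar> \<le> e' * (v - u)"
      by metis
    show "\<exists>\<gamma>. gauge \<gamma> \<and> (\<forall>\<D>. \<D> tagged_division_of {a..b} \<and> \<gamma> fine \<D> \<longrightarrow>
            norm ((\<Sum>(x,k)\<in>\<D>. measure lborel k *\<^sub>R g x) - (f b - f a)) < e)"
    proof (intro exI[of _ "\<lambda>x. ball x (d x)"] conjI allI impI; (elim conjE)?)
      show "gauge (\<lambda>x. ball x (d x))"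
        using d(1) gauge_ball_dependent by blast
      fix p assume p: "p tagged_division_of {a..b}" and fine: "(\<lambda>x. ball x (d x)) fine p"
      define q where "q = {(x,k) \<in> p. x \<in> N}"
      have "finite p"
        using p by blast
      have pk: "k = {Inf k..Sup k} \<and> Inf k \<le> x \<and> x \<le> Sup k \<and> Inf k \<in> {a..b} \<and> Sup k \<in> {a..b}
                \<and> x \<in> {a..b} \<and> k \<subseteq> ball x (d x)
                \<and> measure lborel k = Sup k - Inf k \<and> measure lebesgue k = Sup k - Inf k" if mem: "(x, k) \<in> p" for x k
      proof -
        obtain u v where "k = cbox u v" "x \<in> k" "k \<subseteq> {a..b}"
          using tagged_division_ofD(2-4)[OF p mem] by metis
        then show ?thesis
          using fineD[OF fine mem] by auto
      qed
      let ?E = "\<lambda>(x,k). measure lborel k * g x - (f (Sup k) - f (Inf k))"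
      \<comment> \<open>The lengths of all intervals of the tagged division add up to
        \<open>b - a\<close>.\<close>
      have good: "(\<Sum>z\<in>p - q. \<bar>?E z\<bar>) \<le> e / 2"
      proof -
        have "(\<Sum>z\<in>p - q. \<bar>?E z\<bar>) \<le> (\<Sum>(x,k)\<in>p - q. e' * (Sup k - Inf k))"
        proof (rule sum_mono, clarify)
          fix x k assume "(x, k) \<in> p" "(x, k) \<notin> q"
          then have "x \<notin> N" and k: "(x, k) \<in> p"
            by (auto simp: q_def)
          show "\<bar>measure lborel k * g x - (f (Sup k) - f (Inf k))\<bar> \<le> e' * (Sup k - Inf k)"
            using d(3)[of x "Inf k" "Sup k"] pk[OF k] \<open>x \<notin> N\<close> by (auto simp: g_def)
        qed
        also have "\<dots> \<le> (\<Sum>(x,k)\<in>p. e' * (Sup k - Inf k))"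
          using pk \<open>e' > 0\<close> \<open>finite p\<close> by (intro sum_mono2) (force intro!: mult_nonneg_nonneg)+
        also have "\<dots> = e' * (b - a)"
          using additive_tagged_division_1[OF ab p, of "\<lambda>x. x"]
          by (simp add: split_def flip: sum_distrib_left)
        finally show ?thesis
          using \<open>e' * (b - a) \<le> e / 2\<close> by linarith
      qed
      \<comment> \<open>The intervals tagged in \<open>N\<close> do not overlap and lie in
        \<open>U\<close>, so their total length is below \<open>\<delta>\<close>; since
        \<open>g\<close> vanishes at their tags, only increments of \<open>f\<close> remain.\<close>
      have bad: "(\<Sum>z\<in>q. \<bar>?E z\<bar>) < e / 2"
      proof -
        have "q tagged_partial_division_of {a..b}"
          using p tagged_partial_division_subset[of p "{a..b}" q]
          by (auto simp: tagged_division_of_def q_def)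
        then have q: "q tagged_division_of \<Union>(snd ` q)" and div: "(snd ` q) division_of \<Union>(snd ` q)"
          using tagged_partial_division_of_Union_self partial_division_of_tagged_division by blast+
        have sub: "\<Union>(snd ` q) \<subseteq> {a..b}" "\<Union>(snd ` q) \<subseteq> U"
          using pk d(2) tagged_division_ofD(3)[OF p] by (fastforce simp: q_def)+
        have "(\<Sum>k\<in>snd ` q. Sup k - Inf k) = (\<Sum>k\<in>snd ` q. measure lebesgue k)"
        proof (rule sum.cong)
          fix k assume "k \<in> snd ` q"
          then obtain x where "(x, k) \<in> p"
            by (auto simp: q_def)
          then show "Sup k - Inf k = measure lebesgue k"
            using pk by simp
        qed simp
        also have "\<dots> = measure lebesgue (\<Union>(snd ` q))"
          by (rule content_division[OF div])
        also have "\<dots> \<le> measure lebesgue U"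
          using sub(2) U(3) by (intro measure_mono_fmeasurable) (use lmeasurable_division[OF div] in auto)
        finally have "(\<Sum>k\<in>snd ` q. Sup k - Inf k) < \<delta>"
          using U(4) by linarith
        then have "(\<Sum>k\<in>snd ` q. \<bar>f (Sup k) - f (Inf k)\<bar>) < e / 2"
          by (rule \<delta>[OF div sub(1)])
        \<comment> \<open>A sum over tagged pairs becomes one over intervals if the summand vanishes
          whenever the interior is empty. The empty interval is singled out because
          \<open>Sup {}\<close> and \<open>Inf {}\<close> carry no information; singletons give
          \<open>0\<close> anyway.\<close>
        moreover have "(\<Sum>z\<in>q. \<bar>?E z\<bar>) = (\<Sum>(_,k)\<in>q. if k = {} then 0 else \<bar>f (Sup k) - f (Inf k)\<bar>)"
        proof (rule sum.cong[OF refl], clarify)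
          fix x k assume xk: "(x, k) \<in> q"
          then have "k \<noteq> {}" "x \<in> N"
            using tagged_division_ofD(2)[OF q xk] by (auto simp: q_def)
          then show "\<bar>measure lborel k * g x - (f (Sup k) - f (Inf k))\<bar>
              = (if k = {} then 0 else \<bar>f (Sup k) - f (Inf k)\<bar>)"
            by (simp add: g_def abs_minus_commute)
        qed
        moreover have "\<dots> = (\<Sum>k\<in>snd ` q. if k = {} then 0 else \<bar>f (Sup k) - f (Inf k)\<bar>)"
          by (rule sum.over_tagged_division_lemma[OF q]) auto
        moreover have "\<dots> = (\<Sum>k\<in>snd ` q. \<bar>f (Sup k) - f (Inf k)\<bar>)"
          using division_ofD(3)[OF div] by (intro sum.cong) auto
        ultimately show ?thesis
          by simp
      qed
      \<comment> \<open>The increments of \<open>f\<close> over a tagged division telescope to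
        \<open>f b - f a\<close>.\<close>
      have "(\<Sum>(x,k)\<in>p. measure lborel k *\<^sub>R g x) - (f b - f a) = (\<Sum>z\<in>p. ?E z)"
        using additive_tagged_division_1[OF ab p, of f]
        by (simp add: split_def sum_subtractf)
      also have "\<bar>\<dots>\<bar> \<le> (\<Sum>z\<in>p. \<bar>?E z\<bar>)"
        by (rule sum_abs)
      also have "\<dots> = (\<Sum>z\<in>p - q. \<bar>?E z\<bar>) + (\<Sum>z\<in>q. \<bar>?E z\<bar>)"
        using \<open>finite p\<close> by (intro sum.subset_diff) (auto simp: q_def)
      also have "\<dots> < e"
        using good bad by linarith
      finally show "norm ((\<Sum>(x,k)\<in>p. measure lborel k *\<^sub>R g x) - (f b - f a)) < e"
        by simp
    qed
  qed
  then show ?thesis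
    by (rule has_integral_spike[OF N, rotated]) (simp add: g_def)
qed


subsection \<open>Differentiation of indefinite integrals\<close>

lemma AE_lebesgue_on_Ici_iff:
  "(AE t in lebesgue_on {0::real..}. P t) \<longleftrightarrow> (\<exists>N. negligible N \<and> (\<forall>t\<ge>0. t \<notin> N \<longrightarrow> P t))"
  by (subst AE_restrict_space_iff) (auto simp: eventually_ae_filter_negligible)

text \<open>Lebesgue's differentiation theorem for boxes with lower corner \<open>x\<close>; on the
  line these are \<open>{x..x + h}\<close>, so only right difference quotients are covered.\<close>

lemma right_derivative_integral_AE:
  fixes f :: "real \<Rightarrow> real"
  assumes "\<And>a b. f integrable_on {a..b}"
  obtains N where "negligible N"
    and "\<And>x e. \<lbrakk>x \<notin> N; e > 0\<rbrakk> \<Longrightarrow>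
           \<exists>d>0. \<forall>h. 0 < h \<and> h < d \<longrightarrow> \<bar>integral {x..x + h} f / h - f x\<bar> < e"
proof -
  have f: "\<And>a b. f integrable_on cbox a b"
    using assms by simp
  show thesis
    by (rule integrable_ccontinuous_explicit[OF f])
      (rule that; simp add: divide_inverse mult.commute)
qed

text \<open>The left derivative comes from the right derivative for the reflected function.\<close>

theorem integral_has_real_derivative_AE:
  fixes f :: "real \<Rightarrow> real"
  assumes f: "\<And>a b. f integrable_on {a..b}"
  obtains N where "negligible N"
    and "\<And>a x. \<lbrakk>x \<notin> N; a < x\<rbrakk> \<Longrightarrow> ((\<lambda>t. integral {a..t} f) has_real_derivative f x) (at x)"
proof -
  obtain N1 where N1: "negligible N1"
    "\<And>x e. \<lbrakk>x \<notin> N1; e > 0\<rbrakk> \<Longrightarrow>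
       \<exists>d>0. \<forall>h. 0 < h \<and> h < d \<longrightarrow> \<bar>integral {x..x + h} f / h - f x\<bar> < e"
    using right_derivative_integral_AE[of f, OF f] by blast
  have f': "(\<lambda>x. f (- x)) integrable_on {a..b}" for a b
    using f[of "- b" "- a"] Henstock_Kurzweil_Integration.integrable_reflect_real[where f = f and a = "- b" and b = "- a"] by simp
  obtain N2 where N2: "negligible N2"
    "\<And>x e. \<lbrakk>x \<notin> N2; e > 0\<rbrakk> \<Longrightarrow>
       \<exists>d>0. \<forall>h. 0 < h \<and> h < d \<longrightarrow> \<bar>integral {x..x + h} (\<lambda>x. f (- x)) / h - f (- x)\<bar> < e"
    using right_derivative_integral_AE[of "\<lambda>x. f (- x)", OF f'] by blast
  \<comment> \<open>Reflection is linear, hence differentiable, and so preserves null sets.\<close>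
  have "negligible (uminus ` N2)"
    by (rule negligible_differentiable_image_negligible[OF _ N2(1)])
      (auto intro: linear_imp_differentiable_on linear_uminus)
  with N1(1) have "negligible (N1 \<union> uminus ` N2)"
    by (rule negligible_Un)
  then show thesis
  proof (rule that)
    fix a x :: real
    assume x: "x \<notin> N1 \<union> uminus ` N2" and "a < x"
    then have x1: "x \<notin> N1" and x2: "- x \<notin> N2"
      by (auto simp: image_iff)
    show "((\<lambda>t. integral {a..t} f) has_real_derivative f x) (at x)"
      unfolding has_field_derivative_iff LIM_def
    proof (intro allI impI)
      fix e :: real
      assume "e > 0"
      obtain d1 where d1: "d1 > 0"
        "\<And>h. 0 < h \<Longrightarrow> h < d1 \<Longrightarrow> \<bar>integral {x..x + h} f / h - f x\<bar> < e"
        using N1(2)[OF x1 \<open>e > 0\<close>] by blast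
      obtain d2 where d2: "d2 > 0"
        "\<And>h. 0 < h \<Longrightarrow> h < d2 \<Longrightarrow> \<bar>integral {- x..- x + h} (\<lambda>x. f (- x)) / h - f x\<bar> < e"
        using N2(2)[OF x2 \<open>e > 0\<close>] by auto
      show "\<exists>s>0. \<forall>y. y \<noteq> x \<and> dist y x < s \<longrightarrow>
              dist ((integral {a..y} f - integral {a..x} f) / (y - x)) (f x) < e"
      \<comment> \<open>The bound \<open>x - a\<close> keeps \<open>y\<close> above
        \<open>a\<close>, so that the integral from \<open>a\<close> can be split at the smaller of
        \<open>x\<close> and \<open>y\<close>.\<close>
      proof (intro exI[of _ "min (min d1 d2) (x - a)"] conjI allI impI)
        fix y assume y: "y \<noteq> x \<and> dist y x < min (min d1 d2) (x - a)"
        show "dist ((integral {a..y} f - integral {a..x} f) / (y - x)) (f x) < e"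
        proof (cases "x < y")
          case True
          have "integral {a..x} f + integral {x..y} f = integral {a..y} f"
            using True \<open>a < x\<close> by (intro Henstock_Kurzweil_Integration.integral_combine f) auto
          then have "integral {a..y} f - integral {a..x} f = integral {x..y} f"
            by simp
          then show ?thesis
            using d1(2)[of "y - x"] y True by (simp add: dist_real_def)
        next
          case False
          then have "y < x"
            using y by simp
          have "integral {a..y} f + integral {y..x} f = integral {a..x} f"
            using \<open>y < x\<close> y by (intro Henstock_Kurzweil_Integration.integral_combine f) (auto simp: dist_real_def)
          moreover have "integral {- x..- y} (\<lambda>x. f (- x)) = integral {y..x} f"
            by (rule Henstock_Kurzweil_Integration.integral_reflect_real)
          ultimately have "integral {a..y} f - integral {a..x} f = - integral {- x..- y} (\<lambda>x. f (- x))"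
            by simp
          then have "(integral {a..y} f - integral {a..x} f) / (y - x)
              = integral {- x..- y} (\<lambda>x. f (- x)) / (x - y)"
            using \<open>y < x\<close> by (simp add: divide_simps) (simp add: algebra_simps)
          then show ?thesis
            using d2(2)[of "x - y"] y \<open>y < x\<close> by (simp add: dist_real_def)
        qed
      qed (use d1(1) d2(1) \<open>a < x\<close> in simp)
    qed
  qed
qed


text \<open>Agreement spreads to \<open>{0..n * T}\<close> by induction: a point beyond
  \<open>T\<close> is moved back by one period. This reduces uniqueness of the periodic solution to
  one period.\<close>

lemma periodic_nonneg_eqI:
  assumes "periodic_nonneg T f" "periodic_nonneg T g" and T: "T > 0"
    and eq: "\<And>t. t \<in> {0..T} \<Longrightarrow> f t = g t" and "t \<ge> 0"
  shows "f t = g t"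
proof -
  have "\<forall>t. 0 \<le> t \<and> t \<le> real n * T \<longrightarrow> f t = g t" for n
  proof (induction n)
    case 0
    then show ?case
      using eq T by auto
  next
    case (Suc n)
    show ?case
    proof (intro allI impI)
      fix t assume t: "0 \<le> t \<and> t \<le> real (Suc n) * T"
      show "f t = g t"
      proof (cases "t \<le> T")
        case True
        then show ?thesis
          using eq t by simp
      next
        case False
        then have "f (t - T) = g (t - T)"
          using Suc t by (simp add: algebra_simps)
        moreover have "f (t - T + T) = f (t - T)" "g (t - T + T) = g (t - T)"
          using assms(1,2)[unfolded periodic_nonneg_def, rule_format, of "t - T"] False by simp_all
        ultimately show ?thesis
          by simp
      qed
    qed
  qed
  moreover obtain n where "t \<le> real n * T"
    using T by (metis ex_less_of_nat_mult less_imp_le)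
  ultimately show ?thesis
    using \<open>t \<ge> 0\<close> by blast
qed

subsection \<open>The periodic solution\<close>

text \<open>The bound \<open>M\<close> enters through Lipschitz constants only; it does not appear
  in the estimate of the average.\<close>

locale periodic_inflow =
  fixes lam T M :: real and \<sigma> :: "real \<Rightarrow> real"
  assumes lam_pos: "lam > 0" and T_pos: "T > 0"
    and measurable_inflow: "\<sigma> \<in> borel_measurable (lebesgue_on {0..})"
    and inflow_nonneg: "\<And>t. t \<ge> 0 \<Longrightarrow> 0 \<le> \<sigma> t"
    and inflow_le: "\<And>t. t \<ge> 0 \<Longrightarrow> \<sigma> t \<le> M"
    and inflow_periodic: "periodic_nonneg T \<sigma>"
begin

text \<open>The exponent of the integrating factor for
  \<open>z' + (lam + \<sigma>) z = lam\<close>.\<close>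

definition S :: "real \<Rightarrow> real" where
  "S t = lam * t + integral {0..t} \<sigma>"

definition H :: "real \<Rightarrow> real" where
  "H t = lam * integral {0..T} (\<lambda>s. exp (S s)) / (exp (S T) - 1)
         + lam * integral {0..t} (\<lambda>s. exp (S s))"

text \<open>
  Variation of constants for \<open>z = 1 - x\<close>: here \<open>H' = lam * exp S\<close>, and the constant term of \<open>H\<close> is
  forced by \<open>z T = z 0\<close>.
\<close>

definition z :: "real \<Rightarrow> real" where
  "z t = exp (- S t) * H t"

section \<open>The exponent of the integrating factor\<close>

lemma integrable_inflow:
  assumes "a \<ge> 0"
  shows "\<sigma> integrable_on {a..b}"
proof (rule measurable_bounded_by_integrable_imp_integrable_real)
  show "\<sigma> \<in> borel_measurable (lebesgue_on {a..b})"
    using measurable_restrict_mono[OF measurable_inflow] assms by simp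
  show "(\<lambda>_. M) integrable_on {a..b}"
    by (rule integrable_const_ivl)
  show "\<bar>\<sigma> t\<bar> \<le> M" if "t \<in> {a..b}" for t
    using inflow_nonneg[of t] inflow_le[of t] that assms by simp
qed simp

text \<open>Links the Lebesgue integral in \<open>ave\<close> to the gauge integral in
  \<open>S\<close>.\<close>

lemma absolutely_integrable_inflow: "\<sigma> absolutely_integrable_on {0..b}"
  using integrable_inflow[of 0 b] inflow_nonneg
  by (intro nonnegative_absolutely_integrable_1) auto

lemma S_diff:
  assumes "0 \<le> a" "a \<le> b"
  shows "S b - S a = lam * (b - a) + integral {a..b} \<sigma>"
  using Henstock_Kurzweil_Integration.integral_combine[OF assms integrable_inflow]
  by (simp add: S_def algebra_simps)

text \<open>The rate \<open>lam + \<sigma>\<close> lies between \<open>lam\<close> and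
  \<open>lam + M\<close>. The lower bound yields monotonicity and \<open>S T > 0\<close>, the upper
  one Lipschitz continuity.\<close>

lemma S_increment:
  assumes "0 \<le> a" "a \<le> b"
  shows "lam * (b - a) \<le> S b - S a" "S b - S a \<le> (lam + M) * (b - a)"
proof -
  have "0 \<le> integral {a..b} \<sigma>"
    using assms inflow_nonneg by (intro integral_nonneg integrable_inflow) auto
  then show "lam * (b - a) \<le> S b - S a"
    by (simp add: S_diff[OF assms])
  have "integral {a..b} \<sigma> \<le> integral {a..b} (\<lambda>_. M)"
    using assms inflow_le by (intro integral_le integrable_inflow) auto
  then show "S b - S a \<le> (lam + M) * (b - a)"
    using assms by (simp add: S_diff[OF assms] algebra_simps)
qed

lemma M_nonneg: "M \<ge> 0"
  using inflow_nonneg[of 0] inflow_le[of 0] by simp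

lemma S_0: "S 0 = 0"
  by (simp add: S_def)

lemma S_mono: "0 \<le> a \<Longrightarrow> a \<le> b \<Longrightarrow> S a \<le> S b"
  using S_increment(1)[of a b] lam_pos mult_nonneg_nonneg[of lam "b - a"] by linarith

lemma S_nonneg: "t \<ge> 0 \<Longrightarrow> S t \<ge> 0"
  using S_mono[of 0 t] by (simp add: S_0)

lemma S_T_pos: "S T > 0"
  using S_increment(1)[of 0 T] mult_pos_pos[OF lam_pos T_pos] T_pos by (simp add: S_0)

lemma continuous_on_S: "continuous_on {0..} S"
proof (rule lipschitz_on_continuous_on[OF lipschitz_onI])
  show "lam + M \<ge> 0"
    using lam_pos M_nonneg by simp
  have *: "\<bar>S b - S a\<bar> \<le> (lam + M) * (b - a)" if "0 \<le> a" "a \<le> b" for a b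
    using S_increment[OF that] S_mono[OF that] by simp
  show "dist (S a) (S b) \<le> (lam + M) * dist a b" if "a \<in> {0..}" "b \<in> {0..}" for a b
    using *[of a b] *[of b a] that
    by (cases "a \<le> b") (simp_all add: dist_real_def abs_minus_commute)
qed

lemma S_derivative_AE:
  obtains N where "negligible N"
    and "\<And>t. \<lbrakk>t \<ge> 0; t \<notin> N\<rbrakk> \<Longrightarrow> (S has_real_derivative lam + \<sigma> t) (at t within {0..})"
proof -
  \<comment> \<open>Extension by \<open>0\<close> to negative times provides integrability on every
    interval, as the differentiation theorem requires.\<close>
  define f where "f t = (if t \<in> {0..} then \<sigma> t else 0)" for t
  have "f integrable_on {a..b}" for a b
  proof -
    have "\<sigma> integrable_on {max 0 a..b}"
      by (rule integrable_inflow) simp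
    moreover have "{0..} \<inter> {a..b} = {max 0 a..b}"
      by auto
    ultimately show ?thesis
      unfolding f_def integrable_restrict_Int by simp
  qed
  then obtain N where N: "negligible N"
    "\<And>a x. \<lbrakk>x \<notin> N; a < x\<rbrakk> \<Longrightarrow> ((\<lambda>t. integral {a..t} f) has_real_derivative f x) (at x)"
    using integral_has_real_derivative_AE by blast
  have S_eq: "S = (\<lambda>t. lam * t + integral {0..t} f)"
    unfolding S_def by (intro ext arg_cong2[where f = "(+)"] integral_cong) (simp_all add: f_def)
  show thesis
  proof
    \<comment> \<open>The point \<open>0\<close> joins the exceptional set because the derivative is
      available only to the right of the lower limit of integration.\<close>
    show "negligible (insert 0 N)"
      using N(1) by simp
    fix t :: real
    assume t: "t \<ge> 0" "t \<notin> insert 0 N"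
    then have "((\<lambda>t. integral {0..t} f) has_real_derivative \<sigma> t) (at t)"
      using N(2)[of t 0] by (simp add: f_def)
    then have "(S has_real_derivative lam + \<sigma> t) (at t)"
      unfolding S_eq by (auto intro!: derivative_eq_intros)
    then show "(S has_real_derivative lam + \<sigma> t) (at t within {0..})"
      by (rule has_field_derivative_at_within)
  qed
qed

text \<open>Translation by \<open>T\<close> carries the integral over \<open>{T..t + T}\<close> to
  the one over \<open>{0..t}\<close>.\<close>

lemma S_add_T:
  assumes "t \<ge> 0"
  shows "S (t + T) = S t + S T"
proof -
  have "integral {T..t + T} \<sigma> = integral {0..t} (\<sigma> \<circ> (+) T)"
    using has_integral_shift_Icc_real[of \<sigma> T _ 0 t] integrable_inflow[of T "t + T"] T_pos
    by (metis add.left_neutral integrable_integral integral_unique less_imp_le)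
  also have "\<dots> = integral {0..t} \<sigma>"
    using inflow_periodic by (intro integral_cong) (simp add: periodic_nonneg_def add.commute)
  finally show ?thesis
    using S_diff[of T "t + T"] assms T_pos by (simp add: S_def algebra_simps)
qed

section \<open>The integral of the integrating factor\<close>

lemma continuous_on_exp_S: "a \<ge> 0 \<Longrightarrow> continuous_on {a..b} (\<lambda>s. exp (S s))"
  by (intro continuous_intros continuous_on_subset[OF continuous_on_S]) auto

lemma integrable_exp_S: "a \<ge> 0 \<Longrightarrow> (\<lambda>s. exp (S s)) integrable_on {a..b}"
  by (intro integrable_continuous_real continuous_on_exp_S)

text \<open>The integrand \<open>exp (S s)\<close> is continuous, so this derivative exists at every
  time and not merely almost everywhere.\<close>

lemma H_derivative:
  assumes "t \<ge> 0"
  shows "(H has_real_derivative lam * exp (S t)) (at t within {0..})"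
proof -
  have "((\<lambda>u. integral {0..u} (\<lambda>s. exp (S s))) has_real_derivative exp (S t)) (at t within {0..t + 1})"
    using assms by (intro integral_has_real_derivative continuous_on_exp_S) auto
  \<comment> \<open>\<open>{0..t + 1}\<close> is a neighbourhood of \<open>t\<close> relative to the
    half-line.\<close>
  moreover have "at t within {0..t + 1} = at t within {0..}"
    using assms by (intro at_within_nhd[of t "{..<t + 1}"]) auto
  ultimately show ?thesis
    unfolding H_def by (auto intro!: derivative_eq_intros)
qed

lemma H_diff:
  assumes "0 \<le> a" "a \<le> b"
  shows "H b - H a = lam * integral {a..b} (\<lambda>s. exp (S s))"
  using Henstock_Kurzweil_Integration.integral_combine[OF assms integrable_exp_S]
  by (simp add: H_def flip: distrib_left right_diff_distrib)

lemma H_increment: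
  assumes "0 \<le> a" "a \<le> b"
  shows "0 \<le> H b - H a" "H b - H a \<le> lam * exp (S b) * (b - a)"
proof -
  have "0 \<le> integral {a..b} (\<lambda>s. exp (S s))"
    using assms by (intro integral_nonneg integrable_exp_S) auto
  then show "0 \<le> H b - H a"
    using lam_pos by (simp add: H_diff[OF assms])
  have "integral {a..b} (\<lambda>s. exp (S s)) \<le> integral {a..b} (\<lambda>_. exp (S b))"
    using assms S_mono by (intro integral_le integrable_exp_S) auto
  then have "lam * integral {a..b} (\<lambda>s. exp (S s)) \<le> lam * (exp (S b) * (b - a))"
    using assms lam_pos by (intro mult_left_mono) (simp_all add: mult.commute)
  then show "H b - H a \<le> lam * exp (S b) * (b - a)"
    by (simp add: H_diff[OF assms] mult.assoc)
qed

lemma H_0_pos: "H 0 > 0"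
proof -
  have "integral {0..T} (\<lambda>_. 1 :: real) \<le> integral {0..T} (\<lambda>s. exp (S s))"
    using S_nonneg by (intro integral_le integrable_exp_S) auto
  then have "integral {0..T} (\<lambda>s. exp (S s)) > 0"
    using T_pos by simp
  then show ?thesis
    using lam_pos S_T_pos by (simp add: H_def)
qed

lemma H_pos: "t \<ge> 0 \<Longrightarrow> H t > 0"
  using H_increment(1)[of 0 t] H_0_pos by simp

text \<open>Translation by \<open>T\<close> multiplies the integrand by \<open>exp (S T)\<close>.
  The constant \<open>H 0\<close> is the solution \<open>c\<close> of
  \<open>c + lam * I = exp (S T) * c\<close>, where \<open>I\<close> is the integral over one
  period.\<close>

lemma H_add_T:
  assumes "t \<ge> 0"
  shows "H (t + T) = exp (S T) * H t"
proof -
  let ?I = "\<lambda>a b. integral {a..b} (\<lambda>s. exp (S s))"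
  have "?I T (t + T) = integral {0..t} ((\<lambda>s. exp (S s)) \<circ> (+) T)"
    using has_integral_shift_Icc_real[of "\<lambda>s. exp (S s)" T _ 0 t] integrable_exp_S[of T "t + T"] T_pos
    by (metis add.left_neutral integrable_integral integral_unique less_imp_le)
  also have "\<dots> = integral {0..t} (\<lambda>s. exp (S T) * exp (S s))"
    using S_add_T by (intro integral_cong) (simp add: add.commute exp_add)
  also have "\<dots> = exp (S T) * ?I 0 t"
    by simp
  finally have "?I 0 (t + T) = ?I 0 T + exp (S T) * ?I 0 t"
    using Henstock_Kurzweil_Integration.integral_combine[of 0 T "t + T" "\<lambda>s. exp (S s)"]
      integrable_exp_S T_pos assms by simp
  moreover have "exp (S T) - 1 > 0"
    using S_T_pos by simp
  ultimately show ?thesis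
    by (simp add: H_def divide_simps) (simp add: algebra_simps)
qed

section \<open>The explicit periodic solution\<close>

lemma z_pos: "t \<ge> 0 \<Longrightarrow> z t > 0"
  by (simp add: z_def H_pos)

lemma z_add_T: "t \<ge> 0 \<Longrightarrow> z (t + T) = z t"
  by (simp add: z_def H_add_T S_add_T flip: mult.assoc exp_add)

text \<open>The increment of the product \<open>exp (- S) * H\<close> is split into one of each
  factor, and both factors are bounded and Lipschitz on a compact interval.\<close>

lemma lipschitz_on_z: "\<exists>L. L-lipschitz_on {0..b} z"
proof (intro exI lipschitz_onI)
  \<comment> \<open>The first summand belongs to the increment of \<open>H\<close>, the second to
    that of \<open>exp (- S)\<close>; the absolute value makes \<open>?L\<close> nonnegative for
    every \<open>b\<close>.\<close>
  let ?L = "lam * exp (S b) + (lam + M) * \<bar>H b\<bar>"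
  show "0 \<le> ?L"
    using lam_pos M_nonneg by simp
  have *: "\<bar>z t - z s\<bar> \<le> ?L * (t - s)" if "0 \<le> s" "s \<le> t" "t \<le> b" for s t
  proof -
    have "z t - z s = exp (- S t) * (H t - H s) - (exp (- S s) - exp (- S t)) * H s"
      by (simp add: z_def algebra_simps)
    moreover have "\<bar>exp (- S t) * (H t - H s)\<bar> \<le> lam * exp (S b) * (t - s)"
    proof -
      have "\<bar>exp (- S t) * (H t - H s)\<bar> = exp (- S t) * (H t - H s)"
        using H_increment(1)[of s t] that by simp
      also have "\<dots> \<le> 1 * (H t - H s)"
        using H_increment(1)[of s t] S_nonneg[of t] that by (intro mult_right_mono) auto
      also have "\<dots> \<le> lam * exp (S t) * (t - s)"
        using H_increment(2)[of s t] that by simp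
      also have "\<dots> \<le> lam * exp (S b) * (t - s)"
        using S_mono[of t b] lam_pos that by (intro mult_right_mono mult_left_mono) auto
      finally show ?thesis .
    qed
    moreover have "\<bar>(exp (- S s) - exp (- S t)) * H s\<bar> \<le> (lam + M) * (t - s) * \<bar>H b\<bar>"
    proof -
      have "exp (- S s) - exp (- S t) = exp (- S s) * (1 - exp (S s - S t))"
        by (simp add: algebra_simps flip: exp_add)
      also have "\<dots> \<le> 1 * (S t - S s)"
      proof (rule mult_mono)
        show "1 - exp (S s - S t) \<le> S t - S s"
          using exp_ge_add_one_self[of "S s - S t"] by linarith
      qed (use S_nonneg[of s] S_mono[of s t] that in auto)
      finally have "exp (- S s) - exp (- S t) \<le> (lam + M) * (t - s)"
        using S_increment(2)[of s t] that by simp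
      moreover have "0 \<le> exp (- S s) - exp (- S t)"
        using S_mono[of s t] that by simp
      moreover have "0 < H s" "H s \<le> H b"
        using H_pos[of s] H_increment(1)[of s b] that by auto
      ultimately show ?thesis
        unfolding abs_mult
        by (intro mult_mono mult_nonneg_nonneg) (use lam_pos M_nonneg that in auto)
    qed
    ultimately have "\<bar>z t - z s\<bar> \<le> lam * exp (S b) * (t - s) + (lam + M) * (t - s) * \<bar>H b\<bar>"
      by linarith
    then show ?thesis
      by (simp add: algebra_simps)
  qed
  show "dist (z s) (z t) \<le> ?L * dist s t" if "s \<in> {0..b}" "t \<in> {0..b}" for s t
    using *[of s t] *[of t s] that
    by (cases "s \<le> t") (simp_all add: dist_real_def abs_minus_commute)
qed

lemma continuous_on_z: "continuous_on {0..b} z"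
  using lipschitz_on_z lipschitz_on_continuous_on by blast

text \<open>Product rule, with \<open>exp (- S t) * (lam * exp (S t)) = lam\<close>; the exceptional
  set is that of \<open>S\<close>.\<close>

lemma z_derivative_AE:
  obtains N where "negligible N"
    and "\<And>t. \<lbrakk>t \<ge> 0; t \<notin> N\<rbrakk> \<Longrightarrow> (z has_real_derivative lam - (lam + \<sigma> t) * z t) (at t within {0..})"
proof -
  obtain N where N: "negligible N"
    "\<And>t. \<lbrakk>t \<ge> 0; t \<notin> N\<rbrakk> \<Longrightarrow> (S has_real_derivative lam + \<sigma> t) (at t within {0..})"
    using S_derivative_AE by blast
  show thesis
  proof (rule that[OF N(1)])
    fix t :: real
    assume t: "t \<ge> 0" "t \<notin> N"
    show "(z has_real_derivative lam - (lam + \<sigma> t) * z t) (at t within {0..})"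
      unfolding z_def
      by (rule derivative_eq_intros N(2)[OF t] H_derivative[OF t(1)] refl)+
        (simp add: algebra_simps exp_minus)
  qed
qed

lemma bottleneck_solution_z: "bottleneck_solution lam \<sigma> (restrict (\<lambda>t. 1 - z t) {0..})"
  unfolding bottleneck_solution_def
proof (intro conjI allI impI)
  fix b :: real
  obtain L where "L-lipschitz_on {0..b} z"
    using lipschitz_on_z by blast
  then have "L-lipschitz_on {0..b} (restrict (\<lambda>t. 1 - z t) {0..})"
    unfolding lipschitz_on_def by (simp add: dist_real_def abs_minus_commute)
  then show "abs_continuous_on {0..b} (restrict (\<lambda>t. 1 - z t) {0..})"
    by (rule lipschitz_on_imp_abs_continuous_on)
next
  obtain N where N: "negligible N"
    "\<And>t. \<lbrakk>t \<ge> 0; t \<notin> N\<rbrakk> \<Longrightarrow> (z has_real_derivative lam - (lam + \<sigma> t) * z t) (at t within {0..})"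
    using z_derivative_AE by blast
  let ?x = "restrict (\<lambda>t. 1 - z t) {0..}"
  have "(?x has_real_derivative \<sigma> t * (1 - ?x t) - lam * ?x t) (at t within {0..})"
    if t: "t \<ge> 0" "t \<notin> N" for t
  \<comment> \<open>The restriction agrees with \<open>1 - z\<close> on all of \<open>{0..}\<close>,
    so any radius serves.\<close>
  proof (rule has_field_derivative_transform_within[OF _ zero_less_one])
    show "((\<lambda>t. 1 - z t) has_real_derivative \<sigma> t * (1 - ?x t) - lam * ?x t) (at t within {0..})"
      using t by (auto intro!: derivative_eq_intros N(2) simp: algebra_simps)
  qed (use t in auto)
  then show "AE t in lebesgue_on {0..}.
      (?x has_real_derivative \<sigma> t * (1 - ?x t) - lam * ?x t) (at t within {0..})"
    unfolding AE_lebesgue_on_Ici_iff using N(1) by blast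
qed

section \<open>Uniqueness of the periodic solution\<close>

text \<open>The difference \<open>w\<close> satisfies \<open>w' = - (lam + \<sigma>) * w\<close>
  almost everywhere, so the derivative of its square is at most \<open>- 2 * lam\<close> times the
  square. Over a period the square has no net change, hence its integral is
  \<open>0\<close>.\<close>

lemma periodic_bottleneck_solution_unique:
  assumes x: "bottleneck_solution lam \<sigma> x" "periodic_nonneg T x"
    and y: "bottleneck_solution lam \<sigma> y" "periodic_nonneg T y" and "t \<ge> 0"
  shows "x t = y t"
proof (rule periodic_nonneg_eqI[OF x(2) y(2) T_pos _ \<open>t \<ge> 0\<close>])
  define w where "w t = x t - y t" for t
  obtain N1 where N1: "negligible N1" "\<And>t. \<lbrakk>t \<ge> 0; t \<notin> N1\<rbrakk>
      \<Longrightarrow> (x has_real_derivative \<sigma> t * (1 - x t) - lam * x t) (at t within {0..})"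
    using x(1) unfolding bottleneck_solution_def AE_lebesgue_on_Ici_iff by blast
  obtain N2 where N2: "negligible N2" "\<And>t. \<lbrakk>t \<ge> 0; t \<notin> N2\<rbrakk>
      \<Longrightarrow> (y has_real_derivative \<sigma> t * (1 - y t) - lam * y t) (at t within {0..})"
    using y(1) unfolding bottleneck_solution_def AE_lebesgue_on_Ici_iff by blast
  have ac: "abs_continuous_on {0..T} w"
    unfolding w_def using x(1) y(1) T_pos
    by (intro abs_continuous_on_diff) (auto simp: bottleneck_solution_def)
  then have cont: "continuous_on {0..T} w"
    by (rule abs_continuous_on_imp_continuous_on)
  have ac2: "abs_continuous_on {0..T} (\<lambda>t. (w t)\<^sup>2)"
  proof -
    obtain B where B: "\<And>v. v \<in> w ` {0..T} \<Longrightarrow> \<bar>v\<bar> \<le> B" "B > 0"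
      using compact_imp_bounded[OF compact_continuous_image[OF cont compact_Icc]]
      unfolding bounded_pos by auto
    \<comment> \<open>Squaring is Lipschitz on the bounded range of \<open>w\<close>, by factoring
      the difference of squares.\<close>
    have "(2 * B)-lipschitz_on (w ` {0..T}) (\<lambda>v. v\<^sup>2)"
    proof (rule lipschitz_onI)
      fix u v assume "u \<in> w ` {0..T}" "v \<in> w ` {0..T}"
      then have "\<bar>u + v\<bar> \<le> 2 * B"
        using B(1)[of u] B(1)[of v] by linarith
      then have "\<bar>u + v\<bar> * \<bar>u - v\<bar> \<le> 2 * B * \<bar>u - v\<bar>"
        by (intro mult_right_mono) auto
      then show "dist (u\<^sup>2) (v\<^sup>2) \<le> 2 * B * dist u v"
        by (simp add: dist_real_def power2_eq_square square_diff_square_factored flip: abs_mult)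
    qed (use B(2) in simp)
    then show ?thesis
      by (rule abs_continuous_on_lipschitz_compose[OF ac])
  qed
  have "((\<lambda>t. - 2 * (lam + \<sigma> t) * (w t)\<^sup>2) has_integral (w T)\<^sup>2 - (w 0)\<^sup>2) {0..T}"
  proof (rule fundamental_theorem_of_calculus_abs_continuous[OF ac2])
    show "negligible (N1 \<union> N2)"
      using N1(1) N2(1) by (rule negligible_Un)
    fix t assume t: "t \<in> {0..T} - (N1 \<union> N2)"
    then have "(w has_real_derivative - (lam + \<sigma> t) * w t) (at t within {0..})"
      unfolding w_def
      by (auto intro!: derivative_eq_intros N1(2) N2(2) simp: algebra_simps)
    then have "((\<lambda>t. (w t)\<^sup>2) has_real_derivative - 2 * (lam + \<sigma> t) * (w t)\<^sup>2) (at t within {0..})"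
      by (auto intro!: derivative_eq_intros simp: power2_eq_square algebra_simps)
    then show "((\<lambda>t. (w t)\<^sup>2) has_real_derivative - 2 * (lam + \<sigma> t) * (w t)\<^sup>2) (at t within {0..T})"
      by (rule DERIV_subset) auto
  qed (use T_pos in simp)
  moreover have "w T = w 0"
    using x(2) y(2) unfolding periodic_nonneg_def w_def by (metis add_0 order_refl)
  ultimately have decay: "((\<lambda>t. - 2 * (lam + \<sigma> t) * (w t)\<^sup>2) has_integral 0) {0..T}"
    by simp
  have sq: "(\<lambda>t. (w t)\<^sup>2) integrable_on {0..T}"
    by (intro integrable_continuous_real continuous_intros cont)
  have "0 \<le> integral {0..T} (\<lambda>t. - 2 * lam * (w t)\<^sup>2)"
  proof (rule has_integral_le[OF decay])
    show "((\<lambda>t. - 2 * lam * (w t)\<^sup>2) has_integral integral {0..T} (\<lambda>t. - 2 * lam * (w t)\<^sup>2)) {0..T}"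
      using sq by (intro integrable_integral integrable_on_mult_right)
    show "- 2 * (lam + \<sigma> t) * (w t)\<^sup>2 \<le> - 2 * lam * (w t)\<^sup>2" if "t \<in> {0..T}" for t
      using inflow_nonneg[of t] that by (intro mult_right_mono) auto
  qed
  then have "integral {0..T} (\<lambda>t. (w t)\<^sup>2) \<le> 0"
    using lam_pos by (simp add: mult_le_0_iff)
  moreover have "0 \<le> integral {0..T} (\<lambda>t. (w t)\<^sup>2)"
    using sq by (rule integral_nonneg) simp
  ultimately have "((\<lambda>t. (w t)\<^sup>2) has_integral 0) {0..T}"
    using sq by (metis integrable_integral order_antisym)
  \<comment> \<open>A continuous nonnegative function with integral \<open>0\<close> vanishes
    everywhere on the interval.\<close>
  then show "x t = y t" if "t \<in> {0..T}" for t
    using has_integral_0_cbox_imp_0[of 0 T "\<lambda>t. (w t)\<^sup>2" t] that T_pos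
    by (auto simp: w_def[abs_def, symmetric] w_def[of t] intro!: continuous_intros cont)
qed

text \<open>Replaces the definite description by the explicit formula; extensionality turns
  uniqueness on \<open>{0..}\<close> into equality of functions.\<close>

lemma periodic_solution_eq: "periodic_solution lam T \<sigma> = restrict (\<lambda>t. 1 - z t) {0..}"
  unfolding periodic_solution_def
proof (rule the_equality)
  have per: "periodic_nonneg T (restrict (\<lambda>t. 1 - z t) {0..})"
    using T_pos z_add_T by (simp add: periodic_nonneg_def)
  then show "restrict (\<lambda>t. 1 - z t) {0..} \<in> extensional {0..} \<and>
      bottleneck_solution lam \<sigma> (restrict (\<lambda>t. 1 - z t) {0..}) \<and>
      periodic_nonneg T (restrict (\<lambda>t. 1 - z t) {0..})"
    using bottleneck_solution_z by simp
  fix x assume x: "x \<in> extensional {0..} \<and> bottleneck_solution lam \<sigma> x \<and> periodic_nonneg T x"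
  show "x = restrict (\<lambda>t. 1 - z t) {0..}"
  proof (rule extensionalityI)
    show "x t = restrict (\<lambda>t. 1 - z t) {0..} t" if "t \<in> {0..}" for t
      using periodic_bottleneck_solution_unique[OF _ _ bottleneck_solution_z per] x that by simp
  qed (use x in auto)
qed

subsection \<open>The bound on the average\<close>

text \<open>Since \<open>lam / z = H' / H\<close>, this is the periodicity of \<open>ln z = ln H - S\<close>.\<close>

lemma has_integral_inverse_z: "((\<lambda>t. lam / z t) has_integral S T) {0..T}"
proof -
  have "((\<lambda>t. lam / z t) has_integral ln (H T) - ln (H 0)) {0..T}"
  proof (rule fundamental_theorem_of_calculus)
    fix t assume t: "t \<in> {0..T}"
    then have "((\<lambda>t. ln (H t)) has_real_derivative lam / z t) (at t within {0..})"
      by (auto intro!: derivative_eq_intros H_derivative simp: H_pos z_def exp_minus field_simps)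
    then show "((\<lambda>t. ln (H t)) has_vector_derivative lam / z t) (at t within {0..T})"
      unfolding has_real_derivative_iff_has_vector_derivative[symmetric]
      by (rule DERIV_subset) auto
  qed (use T_pos in simp)
  \<comment> \<open>\<open>H T = exp (S T) * H 0\<close>, by quasi-periodicity at time
    \<open>0\<close>.\<close>
  moreover have "ln (H T) - ln (H 0) = S T"
    using H_add_T[of 0] H_0_pos by (simp add: ln_mult)
  ultimately show ?thesis
    by simp
qed

lemma S_T_eq: "S T = (lam + ave T \<sigma>) * T"
  using set_lebesgue_integral_eq_integral(2)[OF absolutely_integrable_inflow] T_pos
  by (simp add: S_def ave_def field_simps)

text \<open>The convex function \<open>1 / u\<close> lies above its tangent at
  \<open>u = 1 / q\<close>; with \<open>u = 1 / z t\<close> the integral of the tangent is known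
  from that of \<open>lam / z\<close>.\<close>

theorem ave_periodic_solution_le:
  "ave T (\<lambda>t. lam * periodic_solution lam T \<sigma> t) \<le> lam * ave T \<sigma> / (lam + ave T \<sigma>)"
proof -
  define m where "m = ave T \<sigma>"
  have "(lam + m) * T > 0"
    using S_T_pos by (simp add: S_T_eq m_def)
  then have m: "lam + m > 0"
    using T_pos by (simp add: zero_less_mult_iff)
  \<comment> \<open>\<open>q\<close> is the equilibrium of \<open>z' = lam - (lam + m) * z\<close>,
    that is, of the system with constant inflow \<open>m\<close>.\<close>
  define q where "q = lam / (lam + m)"
  have "q > 0"
    using lam_pos m by (simp add: q_def)
  have z: "z integrable_on {0..T}"
    by (intro integrable_continuous_real continuous_on_z)
  have "((\<lambda>t. 2 * q - q\<^sup>2 / lam * (lam / z t)) has_integral 2 * q * T - q\<^sup>2 / lam * S T) {0..T}"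
    using T_pos has_integral_const_real[of "2 * q" 0 T]
    by (intro has_integral_diff has_integral_mult_right has_integral_inverse_z) (simp add: mult.commute)
  moreover have "2 * q * T - q\<^sup>2 / lam * S T = q * T"
  proof -
    have "q * (lam + m) = lam"
      using m by (simp add: q_def)
    then have "q\<^sup>2 / lam * (lam + m) = q"
      using lam_pos by (simp add: power2_eq_square mult.assoc)
    then show ?thesis
      unfolding S_T_eq m_def[symmetric] by (simp flip: mult.assoc)
  qed
  \<comment> \<open>This is \<open>(z t - q)\<^sup>2 \<ge> 0\<close> divided by
    \<open>z t\<close>.\<close>
  moreover have "2 * q - q\<^sup>2 / lam * (lam / z t) \<le> z t" if "t \<in> {0..T}" for t
  proof -
    have "z t > 0"
      using that by (simp add: z_pos)
    have "0 \<le> (z t - q)\<^sup>2"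
      by simp
    then show ?thesis
      using \<open>z t > 0\<close> lam_pos by (simp add: field_simps power2_eq_square)
  qed
  ultimately have bound: "q * T \<le> integral {0..T} z"
    using has_integral_le[OF _ integrable_integral[OF z]] by metis
  have "(LINT t:{0..T}|lebesgue. periodic_solution lam T \<sigma> t) = (LINT t:{0..T}|lebesgue. 1 - z t)"
    by (intro set_lebesgue_integral_cong) (simp_all add: periodic_solution_eq)
  also have "\<dots> = integral {0..T} (\<lambda>t. 1 - z t)"
    by (intro set_lebesgue_integral_eq_integral absolutely_integrable_continuous_real
        continuous_intros continuous_on_z)
  also have "\<dots> = T - integral {0..T} z"
    using z T_pos by (subst Henstock_Kurzweil_Integration.integral_diff) auto
  also have "\<dots> \<le> m / (lam + m) * T"
    using bound m by (simp add: q_def field_simps)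
  finally have "(LINT t:{0..T}|lebesgue. periodic_solution lam T \<sigma> t) / T \<le> m / (lam + m)"
    using T_pos by (simp add: divide_le_eq)
  then have "lam * ((LINT t:{0..T}|lebesgue. periodic_solution lam T \<sigma> t) / T) \<le> lam * (m / (lam + m))"
    using lam_pos by (intro mult_left_mono) auto
  then show ?thesis
    by (simp add: ave_def[of T "\<lambda>t. lam * periodic_solution lam T \<sigma> t"] m_def)
qed

end

theorem theorem1:
  fixes lam T \<sigma>\<^sub>1 \<sigma>\<^sub>2 \<sigma>bar :: real and \<sigma> :: "real \<Rightarrow> real"
  assumes "lam > 0" and "T > 0"
    and "0 < \<sigma>\<^sub>1" and "\<sigma>\<^sub>1 < \<sigma>bar" and "\<sigma>bar < \<sigma>\<^sub>2"
    and "(\<sigma>\<^sub>1 + \<sigma>\<^sub>2) / 2 = \<sigma>bar"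
    and "\<sigma> \<in> admissible_inflows lam \<sigma>\<^sub>1 \<sigma>\<^sub>2 \<sigma>bar T"
  shows "performance lam \<sigma>bar T \<sigma> \<le> 1 \<and>
         1 / T * (LINT t:{0..T}|lebesgue. lam * periodic_solution lam T \<sigma> t)
           \<le> lam * \<sigma>bar / (lam + \<sigma>bar)"
proof -
  have \<sigma>: "\<sigma> \<in> borel_measurable (lebesgue_on {0..})" "\<And>t. t \<ge> 0 \<Longrightarrow> \<sigma> t \<in> {\<sigma>\<^sub>1, \<sigma>bar, \<sigma>\<^sub>2}"
    "periodic_nonneg T \<sigma>" "ave T \<sigma> = \<sigma>bar"
    using assms(7) by (auto simp: admissible_inflows_def)
  \<comment> \<open>The largest of the three values serves as \<open>M\<close>, and
    \<open>0 < \<sigma>\<^sub>1\<close> gives nonnegativity.\<close>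
  interpret periodic_inflow lam T \<sigma>\<^sub>2 \<sigma>
    using \<sigma>(2) assms(1-5) by unfold_locales (use \<sigma>(1,3) in \<open>force+\<close>)
  have "ave T (\<lambda>t. lam * periodic_solution lam T \<sigma> t) \<le> lam * \<sigma>bar / (lam + \<sigma>bar)"
    using ave_periodic_solution_le by (simp add: \<sigma>(4))
  \<comment> \<open>\<open>performance\<close> divides by this quantity, so its positivity makes the
    two conjuncts equivalent.\<close>
  moreover have "lam * \<sigma>bar / (lam + \<sigma>bar) > 0"
    using assms(1,3,4) by simp
  ultimately show ?thesis
    unfolding performance_def by (simp only: divide_le_eq_1_pos ave_def)
qed

end
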